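(* Let $\mathbb F$ be a finite field. For every integer $k$, the class of $\mathbb F$-representable matroids of contraction depth at most $k$ is well-quasi-ordered by the restriction: every infinite sequence $M_1,M_2,\dots$ of such matroids has indices $i<j$ such that $M_i$ is isomorphic to a restriction $M_j\setminus X$ of $M_j$ for some $X\subseteq E(M_j)$.
   Context: Contraction depth $\mathrm{cd}$ of a matroid $M$ is defined recursively: if $E(M)=\emptyset$ it is $0$; if $M$ is disconnected it is the maximum contraction depth of its connected components; if $M$ is connected and $E(M)\ne\emptyset$ it is the minimum $k$ such that $\mathrm{cd}(M/e)\le k-1$ for some $e\in E(M)$. *)

theory Defs
  imports Complex_Main
begin

text \<open>Finite matroids, given by a ground set and a family of independent sets.\<close>

definition matroid_axioms :: "'a set \<Rightarrow> 'a set set \<Rightarrow> bool" where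
  "matroid_axioms E I \<longleftrightarrow>
     finite E \<and> I \<subseteq> Pow E \<and> {} \<in> I \<and>
     (\<forall>X\<in>I. \<forall>Y\<subseteq>X. Y \<in> I) \<and>
     (\<forall>X\<in>I. \<forall>Y\<in>I. card X < card Y \<longrightarrow> (\<exists>y\<in>Y - X. insert y X \<in> I))"

typedef 'a matroid = "{(E :: 'a set, I). matroid_axioms E I}"
  by (rule exI[of _ "({}, {{}})"]) (auto simp: matroid_axioms_def)

definition ground :: "'a matroid \<Rightarrow> 'a set" where
  "ground M = fst (Rep_matroid M)"

definition indep :: "'a matroid \<Rightarrow> 'a set \<Rightarrow> bool" where
  "indep M X \<longleftrightarrow> X \<in> snd (Rep_matroid M)"

lemma matroid_axioms_matroid: "matroid_axioms (ground M) {X. indep M X}"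
  using Rep_matroid[of M] by (auto simp: ground_def indep_def)

lemma finite_ground [simp]: "finite (ground M)"
  and indep_subset_ground: "indep M X \<Longrightarrow> X \<subseteq> ground M"
  and indep_empty [simp]: "indep M {}"
  and indep_subset: "indep M X \<Longrightarrow> Y \<subseteq> X \<Longrightarrow> indep M Y"
  and indep_augment: "indep M X \<Longrightarrow> indep M Y \<Longrightarrow> card X < card Y \<Longrightarrow> \<exists>y\<in>Y - X. indep M (insert y X)"
proof -
  note ax = matroid_axioms_matroid[of M, unfolded matroid_axioms_def mem_Collect_eq]
  show "finite (ground M)" "indep M {}"
    using ax by simp_all
  show "indep M X \<Longrightarrow> X \<subseteq> ground M"
    using ax[THEN conjunct2, THEN conjunct1] by blast
  show "indep M X \<Longrightarrow> Y \<subseteq> X \<Longrightarrow> indep M Y"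
    using ax[THEN conjunct2, THEN conjunct2, THEN conjunct2, THEN conjunct1] by blast
  show "indep M X \<Longrightarrow> indep M Y \<Longrightarrow> card X < card Y \<Longrightarrow> \<exists>y\<in>Y - X. indep M (insert y X)"
    using ax[THEN conjunct2, THEN conjunct2, THEN conjunct2, THEN conjunct2] by blast
qed

lemma finite_indep: "indep M X \<Longrightarrow> finite X"
  by (rule finite_subset[OF indep_subset_ground finite_ground])

lemma
  assumes "matroid_axioms E I"
  shows ground_Abs_matroid: "ground (Abs_matroid (E, I)) = E"
    and indep_Abs_matroid: "indep (Abs_matroid (E, I)) X \<longleftrightarrow> X \<in> I"
  using assms by (simp_all add: ground_def indep_def Abs_matroid_inverse)

definition delete :: "'a matroid \<Rightarrow> 'a set \<Rightarrow> 'a matroid" where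
  "delete M X = Abs_matroid (ground M - X, {Y. indep M Y \<and> Y \<inter> X = {}})"

lemma matroid_axioms_delete: "matroid_axioms (ground M - X) {Y. indep M Y \<and> Y \<inter> X = {}}"
  unfolding matroid_axioms_def
proof (intro conjI ballI impI allI)
  fix A B assume AB: "A \<in> {Y. indep M Y \<and> Y \<inter> X = {}}" "B \<in> {Y. indep M Y \<and> Y \<inter> X = {}}"
    "card A < card B"
  then obtain y where "y \<in> B - A" "indep M (insert y A)" using indep_augment[of M A B] by blast
  with AB show "\<exists>y\<in>B - A. insert y A \<in> {Y. indep M Y \<and> Y \<inter> X = {}}" by blast
next
  fix A B assume "A \<in> {Y. indep M Y \<and> Y \<inter> X = {}}" "B \<subseteq> A"
  then show "B \<in> {Y. indep M Y \<and> Y \<inter> X = {}}"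
    using indep_subset[of M A B] by blast
next
  show "{Y. indep M Y \<and> Y \<inter> X = {}} \<subseteq> Pow (ground M - X)"
    using indep_subset_ground by blast
qed simp_all

lemma ground_delete [simp]: "ground (delete M X) = ground M - X"
  and indep_delete: "indep (delete M X) Y \<longleftrightarrow> indep M Y \<and> Y \<inter> X = {}"
  unfolding delete_def
  by (simp_all add: ground_Abs_matroid[OF matroid_axioms_delete] indep_Abs_matroid[OF matroid_axioms_delete])

definition restrict_to :: "'a matroid \<Rightarrow> 'a set \<Rightarrow> 'a matroid" where
  "restrict_to M S = delete M (ground M - S)"

text \<open>Contracting a loop is the same as deleting it.\<close>

definition contract :: "'a matroid \<Rightarrow> 'a \<Rightarrow> 'a matroid" where
  "contract M e =
     (if indep M {e} then Abs_matroid (ground M - {e}, {Y. e \<notin> Y \<and> indep M (insert e Y)})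
      else delete M {e})"

lemma matroid_axioms_contract:
  assumes "indep M {e}"
  shows "matroid_axioms (ground M - {e}) {Y. e \<notin> Y \<and> indep M (insert e Y)}"
  unfolding matroid_axioms_def
proof (intro conjI ballI impI allI)
  fix A B assume AB: "A \<in> {Y. e \<notin> Y \<and> indep M (insert e Y)}"
    "B \<in> {Y. e \<notin> Y \<and> indep M (insert e Y)}" "card A < card B"
  then have "finite (insert e A)" "finite (insert e B)"
    by (auto dest: finite_indep)
  then have "finite A" "finite B" by simp_all
  with AB have "card (insert e A) < card (insert e B)" by simp
  then obtain y where "y \<in> insert e B - insert e A" "indep M (insert y (insert e A))"
    using AB indep_augment[of M "insert e A" "insert e B"] by blast
  with AB show "\<exists>y\<in>B - A. insert y A \<in> {Y. e \<notin> Y \<and> indep M (insert e Y)}"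
    by (auto simp: insert_commute)
next
  fix A B assume "A \<in> {Y. e \<notin> Y \<and> indep M (insert e Y)}" "B \<subseteq> A"
  then show "B \<in> {Y. e \<notin> Y \<and> indep M (insert e Y)}"
    using indep_subset[of M "insert e A" "insert e B"] by blast
next
  show "{Y. e \<notin> Y \<and> indep M (insert e Y)} \<subseteq> Pow (ground M - {e})"
    using indep_subset_ground by blast
qed (simp_all add: assms)

lemma ground_contract [simp]: "ground (contract M e) = ground M - {e}"
  and indep_contract: "indep (contract M e) Y \<longleftrightarrow>
    e \<notin> Y \<and> (if indep M {e} then indep M (insert e Y) else indep M Y)"
  unfolding contract_def
  by (auto simp: ground_Abs_matroid[OF matroid_axioms_contract]
      indep_Abs_matroid[OF matroid_axioms_contract] indep_delete)

definition matroid_iso :: "'a matroid \<Rightarrow> 'b matroid \<Rightarrow> bool" where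
  "matroid_iso M N \<longleftrightarrow>
     (\<exists>f. bij_betw f (ground M) (ground N) \<and>
          (\<forall>X\<subseteq>ground M. indep M X \<longleftrightarrow> indep N (f ` X)))"

text \<open>Linear independence of the family of columns indexed by a finite set \<open>X\<close> in a matrix with
  rows \<open>0, \<dots>, n - 1\<close>: two distinct elements with the same column are dependent.\<close>

definition columns_independent :: "nat \<Rightarrow> (nat \<Rightarrow> 'a \<Rightarrow> 'f::field) \<Rightarrow> 'a set \<Rightarrow> bool" where
  "columns_independent n A X \<longleftrightarrow>
     (\<forall>c. (\<forall>i<n. (\<Sum>x\<in>X. c x * A i x) = 0) \<longrightarrow> (\<forall>x\<in>X. c x = 0))"

definition representable_over :: "'f::field itself \<Rightarrow> 'a matroid \<Rightarrow> bool" where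
  "representable_over _ M \<longleftrightarrow>
     (\<exists>n (A :: nat \<Rightarrow> 'a \<Rightarrow> 'f). \<forall>X\<subseteq>ground M. indep M X \<longleftrightarrow> columns_independent n A X)"

definition circuit :: "'a matroid \<Rightarrow> 'a set \<Rightarrow> bool" where
  "circuit M C \<longleftrightarrow> C \<subseteq> ground M \<and> \<not> indep M C \<and> (\<forall>D. D \<subset> C \<longrightarrow> indep M D)"

definition same_component :: "'a matroid \<Rightarrow> 'a \<Rightarrow> 'a \<Rightarrow> bool" where
  "same_component M e f \<longleftrightarrow>
     e \<in> ground M \<and> f \<in> ground M \<and> (e = f \<or> (\<exists>C. circuit M C \<and> e \<in> C \<and> f \<in> C))"

definition connected_matroid :: "'a matroid \<Rightarrow> bool" where
  "connected_matroid M \<longleftrightarrow> (\<forall>e\<in>ground M. \<forall>f\<in>ground M. same_component M e f)"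

definition component_sets :: "'a matroid \<Rightarrow> 'a set set" where
  "component_sets M = ground M // {(e, f). same_component M e f}"

lemma ex_circuit:
  assumes "X \<subseteq> ground M" "\<not> indep M X"
  obtains C where "circuit M C" "C \<subseteq> X"
proof -
  let ?S = "{Y. Y \<subseteq> X \<and> \<not> indep M Y}"
  have "finite ?S"
    by (rule finite_subset[of _ "Pow (ground M)"]) (use assms(1) in auto)
  moreover have "X \<in> ?S" using assms(2) by simp
  ultimately have "\<exists>C\<in>?S. C \<subseteq> X \<and> (\<forall>D\<in>?S. D \<subseteq> C \<longrightarrow> C = D)"
    by (rule finite_has_minimal2)
  then obtain C where C: "C \<in> ?S" "\<forall>D\<in>?S. D \<subseteq> C \<longrightarrow> C = D"
    by (elim bexE conjE) (rule that)
  have "circuit M C"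
    unfolding circuit_def
  proof (intro conjI allI impI)
    fix D assume D: "D \<subset> C"
    then have "D \<notin> ?S" using C(2) by blast
    then show "indep M D" using D C(1) by auto
  qed (use C(1) assms(1) in auto)
  then show thesis using that C(1) by simp
qed

lemma ex_maximal_indep:
  assumes "X \<subseteq> U" "indep M X" "U \<subseteq> ground M"
  obtains I where "X \<subseteq> I" "I \<subseteq> U" "indep M I" "\<And>y. y \<in> U - I \<Longrightarrow> \<not> indep M (insert y I)"
proof -
  let ?S = "{Y. Y \<subseteq> U \<and> indep M Y}"
  have "finite ?S"
    by (rule finite_subset[of _ "Pow (ground M)"]) (use assms(3) in auto)
  moreover have "X \<in> ?S" using assms(1,2) by simp
  ultimately have "\<exists>I\<in>?S. X \<subseteq> I \<and> (\<forall>D\<in>?S. I \<subseteq> D \<longrightarrow> I = D)"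
    by (rule finite_has_maximal2)
  then obtain I where "X \<subseteq> I" "I \<in> ?S" "\<forall>D\<in>?S. I \<subseteq> D \<longrightarrow> I = D"
    by (elim bexE conjE) (rule that)
  then have I: "X \<subseteq> I" "I \<subseteq> U" "indep M I"
      "\<And>D. D \<subseteq> U \<Longrightarrow> indep M D \<Longrightarrow> I \<subseteq> D \<Longrightarrow> I = D" by simp_all
  have "\<not> indep M (insert y I)" if "y \<in> U - I" for y
    using I(4)[of "insert y I"] I(2) that by blast
  with I(1-3) show thesis by (rule that)
qed

lemma strong_circuit_elimination:
  assumes C: "circuit M C1" "circuit M C2" and x: "x \<in> C1 \<inter> C2" and e: "e \<in> C1 - C2"
  obtains C3 where "circuit M C3" "e \<in> C3" "C3 \<subseteq> (C1 \<union> C2) - {x}"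
proof -
  let ?U = "C1 \<union> C2"
  have U: "?U \<subseteq> ground M" using C unfolding circuit_def by blast
  have "C2 - {x} \<subset> C2" "C1 - {e} \<subset> C1" using x e by auto
  with C have i2: "indep M (C2 - {x})" and i1: "indep M (C1 - {e})"
    unfolding circuit_def by simp_all
  have "C2 - {x} \<subseteq> ?U - {e, x}" "?U - {e, x} \<subseteq> ground M" using e U by auto
  then obtain I
    where I: "C2 - {x} \<subseteq> I" "I \<subseteq> ?U - {e, x}" "indep M I"
      "\<And>y. y \<in> ?U - {e, x} - I \<Longrightarrow> \<not> indep M (insert y I)"
    by (rule ex_maximal_indep[OF _ i2]) (rule that)
  have "C1 - {e} \<subseteq> ?U - {e}" "?U - {e} \<subseteq> ground M" using U by auto
  then obtain J
    where J: "C1 - {e} \<subseteq> J" "J \<subseteq> ?U - {e}" "indep M J"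
      "\<And>y. y \<in> ?U - {e} - J \<Longrightarrow> \<not> indep M (insert y J)"
    by (rule ex_maximal_indep[OF _ i1]) (rule that)
  have Ix: "\<not> indep M (insert x I)"
    using C(2) I(1) indep_subset[of M "insert x I" C2] unfolding circuit_def by blast
  have Je: "\<not> indep M (insert e J)"
    using C(1) J(1) indep_subset[of M "insert e J" C1] unfolding circuit_def by blast
  have "card J \<le> card I"
  proof (rule ccontr)
    assume "\<not> card J \<le> card I"
    then obtain y where "y \<in> J - I" "indep M (insert y I)"
      using indep_augment[OF I(3) J(3)] by auto
    with I(4)[of y] J(2) Ix show False by blast
  qed
  have dep: "\<not> indep M (insert e I)"
  proof
    assume ie: "indep M (insert e I)"
    have "e \<notin> I" using I(2) by blast
    then have "card J < card (insert e I)"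
      using \<open>card J \<le> card I\<close> finite_indep[OF I(3)] by simp
    then obtain y where "y \<in> insert e I - J" "indep M (insert y J)"
      using indep_augment[OF J(3) ie] by auto
    with J(4)[of y] I(2) Je show False by blast
  qed
  have "insert e I \<subseteq> ground M" using I(2) U e by blast
  then obtain C3 where C3: "circuit M C3" "C3 \<subseteq> insert e I"
    by (rule ex_circuit[OF _ dep]) (rule that)
  have "e \<in> C3"
    using C3 I(3) indep_subset[of M I C3] unfolding circuit_def by blast
  moreover have "C3 \<subseteq> ?U - {x}" using C3(2) I(2) e x by blast
  ultimately show thesis using that C3(1) by blast
qed

lemma circuit_transitive:
  assumes "circuit M D1" "circuit M D2" "e \<in> D1" "g \<in> D2" "D1 \<inter> D2 \<noteq> {}"
  shows "\<exists>C. circuit M C \<and> e \<in> C \<and> g \<in> C"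
  using assms
proof (induction "card (D1 \<union> D2)" arbitrary: D1 D2 rule: less_induct)
  case less
  show ?case
  proof (rule ccontr)
    assume no: "\<not> ?thesis"
    then have e: "e \<in> D1 - D2" and g: "g \<in> D2 - D1" using less.prems by blast+
    have fin: "finite (D1 \<union> D2)"
      using less.prems(1,2) unfolding circuit_def by (meson finite_UnI finite_ground finite_subset)
    from less.prems(5) obtain x where x: "x \<in> D1 \<inter> D2" by blast
    from strong_circuit_elimination[OF less.prems(1,2) x e] obtain C3
      where C3: "circuit M C3" "e \<in> C3" "C3 \<subseteq> (D1 \<union> D2) - {x}" .
    from strong_circuit_elimination[OF less.prems(2,1) _ g, of x] x obtain C4
      where C4: "circuit M C4" "g \<in> C4" "C4 \<subseteq> (D2 \<union> D1) - {x}" by blast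
    have 3: "C3 \<inter> D2 \<noteq> {}"
    proof
      assume "C3 \<inter> D2 = {}"
      then have "C3 \<subset> D1" using C3 x by blast
      then show False using less.prems(1) C3(1) unfolding circuit_def by blast
    qed
    have 4: "C4 \<inter> (D1 - D2) \<noteq> {}"
    proof
      assume "C4 \<inter> (D1 - D2) = {}"
      then have "C4 \<subset> D2" using C4 x by blast
      then show False using less.prems(2) C4(1) unfolding circuit_def by blast
    qed
    have "\<not> C3 \<union> D2 \<subset> D1 \<union> D2"
      using less.hyps[OF _ C3(1) less.prems(2) C3(2) less.prems(4) 3] no
        psubset_card_mono[OF fin] by blast
    then have "D1 - D2 \<subseteq> C3" using C3(3) by blast
    with 4 have "C3 \<inter> C4 \<noteq> {}" by blast
    moreover have "C3 \<union> C4 \<subset> D1 \<union> D2" using C3(3) C4(3) x by blast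
    ultimately show False
      using less.hyps[OF _ C3(1) C4(1) C3(2) C4(2)] no psubset_card_mono[OF fin] by blast
  qed
qed

lemma equiv_same_component: "equiv (ground M) {(e, f). same_component M e f}"
proof (rule equivI)
  show "trans {(e, f). same_component M e f}"
  proof (rule transI, clarify)
    fix e f g assume "same_component M e f" "same_component M f g"
    then show "same_component M e g"
      using circuit_transitive[of M _ _ e g] unfolding same_component_def
      by (metis disjoint_iff)
  qed
next
  show "sym {(e, f). same_component M e f}"
    unfolding sym_def same_component_def by blast
qed (auto simp: same_component_def refl_on_def)

lemma card_component:
  assumes "\<not> connected_matroid M" "C \<in> component_sets M"
  shows "card (ground M \<inter> C) < card (ground M)"
proof -
  from assms(2) obtain g where g: "g \<in> ground M" "C = {(e, f). same_component M e f} `` {g}"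
    unfolding component_sets_def by (auto elim: quotientE)
  have "\<not> ground M \<subseteq> C"
  proof
    assume "ground M \<subseteq> C"
    then have *: "same_component M g h" if "h \<in> ground M" for h using g that by auto
    have "same_component M e f" if "e \<in> ground M" "f \<in> ground M" for e f
      using *[OF that(1)] *[OF that(2)] equiv_same_component[of M]
      by (auto elim!: equivE dest: symD transD)
    with assms(1) show False unfolding connected_matroid_def by blast
  qed
  then show ?thesis by (intro psubset_card_mono) auto
qed

text \<open>The condition \<open>cd(M/e) \<le> k - 1\<close> is stated as \<open>cd(M/e) + 1 \<le> k\<close>, since subtraction on the
  natural numbers truncates.\<close>

function contraction_depth :: "'a matroid \<Rightarrow> nat" where
  "contraction_depth M =
     (if ground M = {} then 0
      else if \<not> connected_matroid M then
        Max ((\<lambda>C. contraction_depth (restrict_to M C)) ` component_sets M)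
      else (LEAST k. \<exists>e\<in>ground M. contraction_depth (contract M e) + 1 \<le> k))"
  by pat_completeness auto
termination
proof (relation "measure (\<lambda>M. card (ground M))", goal_cases)
  case (2 M C)
  then show ?case using card_component[of M C] by (simp add: restrict_to_def Diff_Diff_Int)
next
  case (3 M k e)
  then show ?case by (simp add: card_gt_0_iff card_Diff_singleton)
qed auto

declare contraction_depth.simps [simp del]

end

(* The induction runs over vector configurations whose elements carry labels from a finite set,
   ordered by label-preserving injections that preserve and reflect linear dependencies. Such a
   configuration is the direct sum of its components, so Higman's lemma reduces everything to the
   connected case. If M is connected, contract an element e that lowers the depth: up to a scalar
   label from the finite field on every remaining element, M is determined by M/e, to which the
   induction hypothesis with a larger label set applies. *)

theory Submission
  imports "HOL-Library.Ramsey" "HOL-Library.Sublist" Defs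
begin

section \<open>Almost full relations and Higman's lemma\<close>

text \<open>The scalars attached to M/e say how the coefficient of e depends on the coefficients of
  the other elements, so they act on linear dependencies and not on independent sets. An isomorphism
  of M/e onto a restriction of M'/e' as plain matroids could not be lifted by means of them; this is
  why the order compares dependencies together with their coefficients.

  Contraction fits restriction because the contracted element is never deleted: e is sent to its
  counterpart e', and whatever is deleted from M'/e' is deleted from M' as well. The element e
  itself is matched by pigeonhole on its label. This is where the finiteness of the field enters:
  one contraction multiplies the number of possible labels by the size of the field, and it has to
  stay finite at every level.

  The induction starts from an empty class, since a nonempty connected matroid has positive
  depth.\<close>

definition almost_full_on :: "('b \<Rightarrow> 'b \<Rightarrow> bool) \<Rightarrow> 'b set \<Rightarrow> bool" where
  "almost_full_on P S \<longleftrightarrow> (\<forall>s :: nat \<Rightarrow> 'b. range s \<subseteq> S \<longrightarrow> (\<exists>i j. i < j \<and> P (s i) (s j)))"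

lemma almost_full_onD:
  fixes s :: "nat \<Rightarrow> 'b"
  assumes "almost_full_on P S" "\<And>i. s i \<in> S"
  obtains i j where "i < j" "P (s i) (s j)"
  using assms unfolding almost_full_on_def by (meson image_subsetI)

text \<open>Ramsey's theorem for pairs, coloured by whether \<open>P\<close> holds. Almost fullness
  excludes an infinite homogeneous set on which \<open>P\<close> always fails.\<close>

lemma almost_full_on_subseq:
  fixes s :: "nat \<Rightarrow> 'b"
  assumes "almost_full_on P S" "\<And>i. s i \<in> S"
  obtains \<phi> :: "nat \<Rightarrow> nat" where "strict_mono \<phi>" "\<And>i j. i < j \<Longrightarrow> P (s (\<phi> i)) (s (\<phi> j))"
proof -
  define col :: "nat set \<Rightarrow> nat" where "col X = (if P (s (Min X)) (s (Max X)) then 0 else 1)" for X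
  have "\<exists>Y t. Y \<subseteq> UNIV \<and> infinite Y \<and> t < 2 \<and> (\<forall>x\<in>Y. \<forall>y\<in>Y. x \<noteq> y \<longrightarrow> col {x, y} = t)"
    by (rule Ramsey2) (auto simp: col_def)
  then obtain Y t where Y: "infinite Y" "\<forall>x\<in>Y. \<forall>y\<in>Y. x \<noteq> y \<longrightarrow> col {x, y} = t"
    by (elim exE conjE) (rule that)
  define \<phi> where "\<phi> = enumerate Y"
  have mono: "strict_mono \<phi>" unfolding \<phi>_def by (rule strict_mono_enumerate[OF Y(1)])
  have col: "col {\<phi> i, \<phi> j} = (if P (s (\<phi> i)) (s (\<phi> j)) then 0 else 1)" if "i < j" for i j
    using strict_monoD[OF mono that] by (simp add: col_def)
  have t: "col {\<phi> i, \<phi> j} = t" if "i < j" for i j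
  proof -
    have "\<phi> i \<in> Y" "\<phi> j \<in> Y" using enumerate_in_set[OF Y(1)] by (simp_all add: \<phi>_def)
    moreover have "\<phi> i \<noteq> \<phi> j" using strict_monoD[OF mono that] by simp
    ultimately show ?thesis using Y(2) by blast
  qed
  obtain i j where "i < j" "P (s (\<phi> i)) (s (\<phi> j))"
    using almost_full_onD[OF assms(1), of "\<lambda>i. s (\<phi> i)"] assms(2) by blast
  then have "t = 0" using col t by fastforce
  then have "P (s (\<phi> i)) (s (\<phi> j))" if "i < j" for i j
    using col[OF that] t[OF that] by (simp split: if_splits)
  with mono show thesis by (rule that)
qed

lemma almost_full_on_finite_colouring:
  fixes s :: "nat \<Rightarrow> 'b" and q :: "nat \<Rightarrow> 'c"
  assumes "almost_full_on P S" "\<And>i. s i \<in> S" "finite (range q)"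
  obtains i j where "i < j" "P (s i) (s j)" "q i = q j"
proof -
  obtain i0 where inf: "infinite {i. q i = q i0}"
    using pigeonhole_infinite[OF _ assms(3)] by auto
  define \<phi> where "\<phi> = enumerate {i. q i = q i0}"
  have mono: "strict_mono \<phi>" unfolding \<phi>_def by (rule strict_mono_enumerate[OF inf])
  have q: "q (\<phi> i) = q i0" for i
    using enumerate_in_set[OF inf, of i] by (simp add: \<phi>_def)
  obtain i j where "i < j" "P (s (\<phi> i)) (s (\<phi> j))"
    using almost_full_onD[OF assms(1), of "\<lambda>i. s (\<phi> i)"] assms(2) by blast
  then show thesis using that[of "\<phi> i" "\<phi> j"] strict_monoD[OF mono] q by simp
qed

text \<open>Nash-Williams' construction: terms are fixed one after another, each of least size among
  the bad sequences that continue the terms already fixed.\<close>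

lemma minimal_bad_sequence:
  fixes size :: "'b \<Rightarrow> nat"
  assumes "\<not> almost_full_on P S"
  obtains m :: "nat \<Rightarrow> 'b" where "\<forall>i. m i \<in> S" "\<forall>i j. i < j \<longrightarrow> \<not> P (m i) (m j)"
    "\<forall>h n. (\<forall>i. h i \<in> S) \<longrightarrow> (\<forall>i j. i < j \<longrightarrow> \<not> P (h i) (h j)) \<longrightarrow> (\<forall>i<n. h i = m i) \<longrightarrow>
       size (m n) \<le> size (h n)"
proof -
  define bad where "bad h \<longleftrightarrow> (\<forall>i. h i \<in> S) \<and> (\<forall>i j. i < j \<longrightarrow> \<not> P (h i) (h j))"
    for h :: "nat \<Rightarrow> 'b"
  define least where
    "least n g \<longleftrightarrow> bad g \<and> (\<forall>h. bad h \<and> (\<forall>i<n. h i = g i) \<longrightarrow> size (g n) \<le> size (h n))" for n g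
  have ex: "\<exists>g'. least n g' \<and> (\<forall>i<n. g' i = g i)" if "bad g" for n g
  proof -
    let ?Q = "\<lambda>h. bad h \<and> (\<forall>i<n. h i = g i)"
    have "\<exists>g'. ?Q g' \<and> (\<forall>h. ?Q h \<longrightarrow> size (g' n) \<le> size (h n))"
      by (rule ex_has_least_nat[where k = g]) (use that in simp)
    then obtain g' where "bad g'" "\<forall>i<n. g' i = g i"
        "\<forall>h. ?Q h \<longrightarrow> size (g' n) \<le> size (h n)"
      by (elim exE conjE) (rule that)
    then show ?thesis unfolding least_def by (intro exI[of _ g']) simp
  qed
  obtain g0 where "bad g0"
    using assms unfolding almost_full_on_def bad_def by blast
  then have "\<exists>g. least 0 g" using ex by blast
  moreover have "\<exists>g'. least (Suc n) g' \<and> (\<forall>i\<le>n. g' i = g i)" if "least n g" for n g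
    using ex[of g "Suc n"] that unfolding least_def by (auto simp: less_Suc_eq_le)
  ultimately obtain f where f: "\<And>n. least n (f n)" "\<And>n. \<forall>i\<le>n. f (Suc n) i = f n i"
    using dependent_nat_choice[of least "\<lambda>n g g'. \<forall>i\<le>n. g' i = g i"] by blast
  \<comment> \<open>Stage \<open>n\<close> fixes term \<open>n\<close> and later stages keep it, so
    \<open>f n\<close> agrees with the diagonal up to index \<open>n\<close>. A claim about finitely
    many terms of \<open>m\<close> thus becomes a claim about a single bad sequence
    \<open>f n\<close>.\<close>
  define m where "m n = f n n" for n
  have agree: "i \<le> n \<Longrightarrow> f n i = m i" for i n
  proof (induction n)
    case (Suc n)
    then show ?case using f(2)[of n] by (cases "i = Suc n") (auto simp: m_def)
  qed (simp add: m_def)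
  show thesis
  proof
    have bad: "bad (f n)" for n using f(1)[of n] by (simp add: least_def)
    show "\<forall>i. m i \<in> S"
      using bad by (simp add: bad_def m_def)
    show "\<forall>i j. i < j \<longrightarrow> \<not> P (m i) (m j)"
    proof (intro allI impI)
      fix i j :: nat assume "i < j"
      then have "\<not> P (f j i) (f j j)" using bad[of j] unfolding bad_def by blast
      then show "\<not> P (m i) (m j)" using agree[of i j] agree[of j j] \<open>i < j\<close> by simp
    qed
    show "\<forall>h n. (\<forall>i. h i \<in> S) \<longrightarrow> (\<forall>i j. i < j \<longrightarrow> \<not> P (h i) (h j)) \<longrightarrow> (\<forall>i<n. h i = m i) \<longrightarrow>
       size (m n) \<le> size (h n)"
    proof (intro allI impI)
      fix h :: "nat \<Rightarrow> 'b" and n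
      assume "\<forall>i. h i \<in> S" "\<forall>i j. i < j \<longrightarrow> \<not> P (h i) (h j)" "\<forall>i<n. h i = m i"
      then have "bad h" "\<forall>i<n. h i = f n i" using agree[of _ n] by (simp_all add: bad_def)
      then have "size (f n n) \<le> size (h n)" using f(1)[of n] unfolding least_def by blast
      then show "size (m n) \<le> size (h n)" by (simp add: m_def)
    qed
  qed
qed

text \<open>In a minimal bad sequence no list is empty. Passing to tails along a subsequence whose
  heads are pairwise related would give another bad sequence with a shorter term at the first
  change.\<close>

theorem Higman:
  assumes "almost_full_on P S"
  shows "almost_full_on (list_emb P) (lists S)"
proof (rule ccontr)
  assume bad: "\<not> ?thesis"
  obtain m :: "nat \<Rightarrow> _" where m': "\<forall>i. m i \<in> lists S" "\<forall>i j. i < j \<longrightarrow> \<not> list_emb P (m i) (m j)"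
    and least: "\<forall>h n. (\<forall>i. h i \<in> lists S) \<longrightarrow> (\<forall>i j. i < j \<longrightarrow> \<not> list_emb P (h i) (h j)) \<longrightarrow>
        (\<forall>i<n. h i = m i) \<longrightarrow> length (m n) \<le> length (h n)"
    by (rule minimal_bad_sequence[OF bad, where size = length]) (rule that)
  note m = m'(1)[rule_format] m'(2)[rule_format]
  have "m i \<noteq> []" for i
    using m(2)[of i "Suc i"] by auto
  then have Cons: "m i = hd (m i) # tl (m i)" for i by simp
  have hd: "hd (m i) \<in> S" and tl: "tl (m i) \<in> lists S" for i
    using m(1)[of i] by (subst (asm) Cons, simp)+
  obtain \<phi> :: "nat \<Rightarrow> nat" where \<phi>: "strict_mono \<phi>"
      "\<And>i j. i < j \<Longrightarrow> P (hd (m (\<phi> i))) (hd (m (\<phi> j)))"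
    using almost_full_on_subseq[OF assms, of "\<lambda>i. hd (m i)"] hd by blast
  \<comment> \<open>The sequence is kept before index \<open>\<phi> 0\<close> and continued by the
    tails along \<open>\<phi>\<close>; the first changed term, at \<open>\<phi> 0\<close>, is one
    element shorter.\<close>
  define h where "h i = (if i < \<phi> 0 then m i else tl (m (\<phi> (i - \<phi> 0))))" for i
  have "length (m (\<phi> 0)) \<le> length (h (\<phi> 0))"
  proof (rule least[rule_format])
    show "h i \<in> lists S" for i using m(1) tl by (simp add: h_def)
    show "\<not> list_emb P (h i) (h j)" if "i < j" for i j
    proof
      assume emb: "list_emb P (h i) (h j)"
      \<comment> \<open>An embedding between terms of \<open>h\<close> lifts to one between terms of
        \<open>m\<close>: unchanged before the splice, with the head put back on the right for a
        mixed pair, and with both heads put back for two tails.\<close>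
      consider "j < \<phi> 0" | "i < \<phi> 0" "\<phi> 0 \<le> j" | "\<phi> 0 \<le> i" by linarith
      then show False
      proof cases
        case 1
        then show False using emb m(2) that by (simp add: h_def)
      next
        case 2
        let ?j = "\<phi> (j - \<phi> 0)"
        have "list_emb P (m i) (hd (m ?j) # tl (m ?j))"
          using emb 2 by (intro list_emb_Cons) (simp add: h_def)
        moreover have "i < ?j"
          using 2 strict_mono_less_eq[OF \<phi>(1), of 0 "j - \<phi> 0"] by simp
        ultimately show False using m(2) Cons by metis
      next
        case 3
        let ?i = "\<phi> (i - \<phi> 0)" and ?j = "\<phi> (j - \<phi> 0)"
        have less: "i - \<phi> 0 < j - \<phi> 0" using that 3 by linarith
        have "list_emb P (hd (m ?i) # tl (m ?i)) (hd (m ?j) # tl (m ?j))"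
          using emb 3 that \<phi>(2)[OF less] by (intro list_emb_Cons2) (simp_all add: h_def)
        then show False using m(2)[OF strict_monoD[OF \<phi>(1) less]] Cons by metis
      qed
    qed
  qed (simp add: h_def)
  then show False using Cons[of "\<phi> 0"] by (metis h_def length_Cons Suc_n_not_le_n diff_self_eq_0 less_irrefl)
qed

text \<open>For lists without repetition, matched positions have distinct entries, so Higman's order
  yields an injection between the underlying finite sets.\<close>

lemma list_emb_inj_on:
  assumes "list_emb P xs ys" "distinct xs" "distinct ys"
  obtains g where "inj_on g (set xs)" "g ` set xs \<subseteq> set ys" "\<And>x. x \<in> set xs \<Longrightarrow> P x (g x)"
proof -
  from assms have "\<exists>g. inj_on g (set xs) \<and> g ` set xs \<subseteq> set ys \<and> (\<forall>x\<in>set xs. P x (g x))"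
  proof (induction rule: list_emb.induct)
    case (list_emb_Cons xs ys y)
    then show ?case by fastforce
  next
    case (list_emb_Cons2 x y xs ys)
    then obtain g where g: "inj_on g (set xs)" "g ` set xs \<subseteq> set ys" "\<forall>x\<in>set xs. P x (g x)"
      by auto
    have "inj_on (g(x := y)) (set (x # xs))"
      using g list_emb_Cons2.prems by (auto simp: inj_on_def)
    moreover have "(g(x := y)) ` set (x # xs) \<subseteq> set (y # ys)"
      using g by auto
    moreover have "\<forall>z\<in>set (x # xs). P z ((g(x := y)) z)"
      using g list_emb_Cons2.hyps by auto
    ultimately show ?case by blast
  qed simp
  then show thesis using that by blast
qed

section \<open>Linear dependencies of represented matroids\<close>

text \<open>All rows are tested, without a bound, so that configurations coming from matrices of
  different heights compare directly; a finite matrix is padded with zero rows.\<close>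

definition dependency :: "(nat \<Rightarrow> 'a \<Rightarrow> 'f::field) \<Rightarrow> 'a set \<Rightarrow> ('a \<Rightarrow> 'f) \<Rightarrow> bool" where
  "dependency A X c \<longleftrightarrow> (\<forall>i. (\<Sum>x\<in>X. c x * A i x) = 0)"

definition represents :: "(nat \<Rightarrow> 'a \<Rightarrow> 'f::field) \<Rightarrow> 'a matroid \<Rightarrow> bool" where
  "represents A M \<longleftrightarrow>
     (\<forall>X\<subseteq>ground M. indep M X \<longleftrightarrow> (\<forall>c. dependency A X c \<longrightarrow> (\<forall>x\<in>X. c x = 0)))"

lemma indep_represents:
  "represents A M \<Longrightarrow> X \<subseteq> ground M \<Longrightarrow>
   indep M X \<longleftrightarrow> (\<forall>c. dependency A X c \<longrightarrow> (\<forall>x\<in>X. c x = 0))"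
  by (simp add: represents_def)

lemma dependent_represents:
  assumes "represents A M" "X \<subseteq> ground M" "\<not> indep M X"
  obtains c x where "dependency A X c" "x \<in> X" "c x \<noteq> 0"
  using assms by (metis indep_represents)

lemma representable_over_represents:
  assumes "representable_over TYPE('f::field) M"
  obtains A :: "nat \<Rightarrow> 'a \<Rightarrow> 'f::field" where "represents A M"
proof -
  obtain n and A :: "nat \<Rightarrow> 'a \<Rightarrow> 'f"
    where A: "\<forall>X\<subseteq>ground M. indep M X \<longleftrightarrow> columns_independent n A X"
    using assms unfolding representable_over_def by blast
  let ?A = "\<lambda>i x. if i < n then A i x else 0"
  have "dependency ?A X c \<longleftrightarrow> (\<forall>i<n. (\<Sum>x\<in>X. c x * A i x) = 0)" for X c
    unfolding dependency_def by (rule all_cong1, case_tac "i < n") simp_all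
  then have "represents ?A M"
    using A unfolding represents_def columns_independent_def by simp
  then show thesis by (rule that)
qed

lemma dependency_cong:
  "(\<And>x. x \<in> X \<Longrightarrow> c x = d x) \<Longrightarrow> (\<And>i x. x \<in> X \<Longrightarrow> A i x = B i x) \<Longrightarrow>
   dependency A X c \<longleftrightarrow> dependency B X d"
  unfolding dependency_def by (metis (no_types, lifting) sum.cong)

lemma dependency_reindex:
  "inj_on f X \<Longrightarrow> dependency A (f ` X) c \<longleftrightarrow> dependency (\<lambda>i x. A i (f x)) X (\<lambda>x. c (f x))"
  unfolding dependency_def by (simp add: sum.reindex)

lemma dependency_superset:
  assumes "finite Y" "X \<subseteq> Y" "\<And>x. x \<in> Y - X \<Longrightarrow> c x = 0"
  shows "dependency A Y c \<longleftrightarrow> dependency A X c"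
proof -
  have "(\<Sum>x\<in>Y. c x * A i x) = (\<Sum>x\<in>X. c x * A i x)" for i
    by (rule sum.mono_neutral_right) (use assms in auto)
  then show ?thesis by (simp add: dependency_def)
qed

lemma dependency_support:
  assumes "finite X"
  shows "dependency A {x \<in> X. c x \<noteq> 0} c \<longleftrightarrow> dependency A X c"
  by (rule dependency_superset[symmetric]) (use assms in auto)

lemma dependency_extend_zero:
  assumes "finite Y" "X \<subseteq> Y"
  shows "dependency A Y (\<lambda>x. if x \<in> X then c x else 0) \<longleftrightarrow> dependency A X c"
proof -
  let ?d = "\<lambda>x. if x \<in> X then c x else 0"
  have "dependency A Y ?d \<longleftrightarrow> dependency A X ?d"
    by (rule dependency_superset) (use assms in auto)
  also have "\<dots> \<longleftrightarrow> dependency A X c"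
    by (rule dependency_cong) auto
  finally show ?thesis .
qed

lemma dependency_diff_scaled:
  assumes "dependency A X c" "dependency A X d"
  shows "dependency A X (\<lambda>x. c x - r * d x)"
proof -
  have "(\<Sum>x\<in>X. (c x - r * d x) * A i x) = (\<Sum>x\<in>X. c x * A i x) - r * (\<Sum>x\<in>X. d x * A i x)" for i
    by (simp add: sum_subtractf sum_distrib_left algebra_simps)
  with assms show ?thesis by (simp add: dependency_def)
qed

text \<open>The support of a nonzero dependency on \<open>C\<close> is itself dependent, hence all
  of \<open>C\<close> by minimality of the circuit. Extension by zero then makes \<open>C\<close>
  the exact support on the ground set.\<close>

lemma represents_circuit:
  assumes "represents A M" "circuit M C"
  obtains d where "dependency A (ground M) d" "\<And>x. d x \<noteq> 0 \<longleftrightarrow> x \<in> C"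
proof -
  have C: "C \<subseteq> ground M" "\<not> indep M C" "\<And>D. D \<subset> C \<Longrightarrow> indep M D"
    using assms(2) by (auto simp: circuit_def)
  obtain c x where c: "dependency A C c" "x \<in> C" "c x \<noteq> 0"
    by (rule dependent_represents[OF assms(1) C(1,2)]) (rule that)
  let ?D = "{x \<in> C. c x \<noteq> 0}"
  have "dependency A ?D c"
    using c(1) unfolding dependency_support[OF finite_subset[OF C(1) finite_ground]] .
  moreover have "?D \<subseteq> ground M" using C(1) by blast
  ultimately have "\<not> indep M ?D"
    using c(2,3) indep_represents[OF assms(1), of ?D] by auto
  then have "?D = C" using C(3)[of ?D] by blast
  then have nz: "c x \<noteq> 0" if "x \<in> C" for x using that by blast
  let ?d = "\<lambda>x. if x \<in> C then c x else 0"
  have "dependency A (ground M) ?d"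
    using c(1) unfolding dependency_extend_zero[OF finite_ground C(1)] .
  then show thesis by (rule that) (use nz in auto)
qed

section \<open>Components\<close>

lemma component_sets_facts:
  shows Union_component_sets: "\<Union> (component_sets M) = ground M"
    and finite_component_sets: "finite (component_sets M)"
    and component_sets_subset: "C \<in> component_sets M \<Longrightarrow> C \<subseteq> ground M"
    and component_sets_nonempty: "C \<in> component_sets M \<Longrightarrow> C \<noteq> {}"
    and component_sets_disjoint:
      "C \<in> component_sets M \<Longrightarrow> D \<in> component_sets M \<Longrightarrow> x \<in> C \<Longrightarrow> x \<in> D \<Longrightarrow> C = D"
    and component_sets_closed: "C \<in> component_sets M \<Longrightarrow> e \<in> C \<Longrightarrow> same_component M e f \<Longrightarrow> f \<in> C"
    and component_sets_same: "C \<in> component_sets M \<Longrightarrow> e \<in> C \<Longrightarrow> f \<in> C \<Longrightarrow> same_component M e f"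
proof -
  note eq = equiv_same_component[of M]
  show U: "\<Union> (component_sets M) = ground M"
    unfolding component_sets_def by (rule Union_quotient[OF eq])
  then show "C \<in> component_sets M \<Longrightarrow> C \<subseteq> ground M" by blast
  show "finite (component_sets M)"
    using U finite_UnionD[of "component_sets M"] by simp
  show "C \<in> component_sets M \<Longrightarrow> C \<noteq> {}"
    unfolding component_sets_def by (rule in_quotient_imp_non_empty[OF eq])
  show "C \<in> component_sets M \<Longrightarrow> D \<in> component_sets M \<Longrightarrow> x \<in> C \<Longrightarrow> x \<in> D \<Longrightarrow> C = D"
    unfolding component_sets_def using quotient_disj[OF eq, of C D] by blast
  show "C \<in> component_sets M \<Longrightarrow> e \<in> C \<Longrightarrow> same_component M e f \<Longrightarrow> f \<in> C"
    unfolding component_sets_def using in_quotient_imp_closed[OF eq, of C e f] by simp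
  show "C \<in> component_sets M \<Longrightarrow> e \<in> C \<Longrightarrow> f \<in> C \<Longrightarrow> same_component M e f"
    unfolding component_sets_def using quotient_eq_iff[OF eq, of C C e f] by simp
qed

lemma circuit_subset_component:
  assumes "circuit M D" "C \<in> component_sets M" "x \<in> D" "x \<in> C"
  shows "D \<subseteq> C"
proof
  fix y assume "y \<in> D"
  then have "same_component M x y"
    using assms unfolding same_component_def circuit_def by blast
  then show "y \<in> C" using component_sets_closed assms by metis
qed

text \<open>Every dependency is a combination of dependencies supported on circuits, and a circuit
  lies inside \<open>C\<close> or misses it. The induction peels off one circuit inside the support
  at a time.\<close>

lemma dependency_component:
  assumes A: "represents A M" and C: "C \<in> component_sets M" and c: "dependency A (ground M) c"
  shows "dependency A C c"
  using c
proof (induction "card {x \<in> ground M. c x \<noteq> 0}" arbitrary: c rule: less_induct)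
  case less
  let ?S = "{x \<in> ground M. c x \<noteq> 0}"
  show ?case
  proof (cases "?S = {}")
    case True
    then show ?thesis
      using component_sets_subset[OF C] by (auto simp: dependency_def intro!: sum.neutral)
  next
    case False
    have "dependency A ?S c"
      using less.prems unfolding dependency_support[OF finite_ground] .
    then have "\<not> indep M ?S" using False indep_represents[OF A, of ?S] by auto
    then obtain D where D: "circuit M D" "D \<subseteq> ?S"
      using ex_circuit[of ?S M] by blast
    then obtain x where x: "x \<in> D" unfolding circuit_def using indep_empty by fastforce
    obtain d where d: "dependency A (ground M) d" "\<And>x. d x \<noteq> 0 \<longleftrightarrow> x \<in> D"
      by (rule represents_circuit[OF A D(1)]) (rule that)
    \<comment> \<open>This factor cancels the coefficient at \<open>x\<close>. As \<open>d\<close>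
      is supported inside the support of \<open>c\<close>, no new nonzero coefficient arises and the
      support shrinks.\<close>
    define r where "r = c x / d x"
    let ?c = "\<lambda>y. c y - r * d y"
    have "{y \<in> ground M. ?c y \<noteq> 0} \<subset> ?S"
    proof
      have "d y = 0" if "c y = 0" "y \<in> ground M" for y using D(2) d(2)[of y] that by auto
      then show "{y \<in> ground M. ?c y \<noteq> 0} \<subseteq> ?S" by auto
      have "?c x = 0" using d(2)[of x] x by (simp add: r_def)
      then show "{y \<in> ground M. ?c y \<noteq> 0} \<noteq> ?S" using x D(2) by blast
    qed
    then have "dependency A C ?c"
      by (intro less.hyps psubset_card_mono dependency_diff_scaled less.prems d(1)) auto
    moreover have "dependency A C d"
    proof (cases "D \<subseteq> C")
      case True
      have "dependency A (ground M) d \<longleftrightarrow> dependency A C d"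
        by (rule dependency_superset) (use True d(2) component_sets_subset[OF C] in auto)
      then show ?thesis using d(1) by blast
    next
      case False
      then have "d y = 0" if "y \<in> C" for y
        using circuit_subset_component[OF D(1) C _ that] d(2) by blast
      then show ?thesis by (simp add: dependency_def)
    qed
    ultimately have "dependency A C (\<lambda>y. ?c y - (- r) * d y)"
      by (rule dependency_diff_scaled)
    then show ?thesis by simp
  qed
qed

text \<open>The direct sum decomposition in terms of dependencies: the row sums over the components
  add up to the row sum over the ground set, and conversely dependencies restrict to
  components.\<close>

lemma dependency_components_iff:
  assumes "represents A M"
  shows "dependency A (ground M) c \<longleftrightarrow> (\<forall>C\<in>component_sets M. dependency A C c)"
proof
  assume *: "\<forall>C\<in>component_sets M. dependency A C c"
  have "(\<Sum>x\<in>ground M. c x * A i x) = (\<Sum>C\<in>component_sets M. \<Sum>x\<in>C. c x * A i x)" for i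
    unfolding Union_component_sets[symmetric]
    by (subst sum.Union_disjoint)
      (auto intro: finite_subset[OF component_sets_subset] dest: component_sets_disjoint)
  with * show "dependency A (ground M) c" by (simp add: dependency_def)
qed (use dependency_component[OF assms] in blast)

lemma ground_restrict_to: "C \<subseteq> ground M \<Longrightarrow> ground (restrict_to M C) = C"
  by (auto simp: restrict_to_def)

lemma indep_restrict_to: "C \<subseteq> ground M \<Longrightarrow> indep (restrict_to M C) X \<longleftrightarrow> indep M X \<and> X \<subseteq> C"
  using indep_subset_ground[of M X] by (auto simp: restrict_to_def indep_delete)

lemma restrict_to_ground: "restrict_to M (ground M) = M"
proof -
  have "restrict_to M (ground M) = Abs_matroid (fst (Rep_matroid M), snd (Rep_matroid M))"
    by (simp add: restrict_to_def delete_def ground_def indep_def)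
  then show ?thesis by (simp add: Rep_matroid_inverse)
qed

lemma represents_restrict_to:
  "represents A M \<Longrightarrow> C \<subseteq> ground M \<Longrightarrow> represents A (restrict_to M C)"
  unfolding represents_def by (auto simp: ground_restrict_to indep_restrict_to)

text \<open>A circuit joining two elements of a component stays inside it, so it survives the
  restriction.\<close>

lemma connected_restrict_to_component:
  assumes C: "C \<in> component_sets M"
  shows "connected_matroid (restrict_to M C)"
  unfolding connected_matroid_def ground_restrict_to[OF component_sets_subset[OF C]]
proof (intro ballI)
  fix e f assume ef: "e \<in> C" "f \<in> C"
  note sub = component_sets_subset[OF C]
  show "same_component (restrict_to M C) e f"
  proof (cases "e = f")
    case False
    then obtain D where D: "circuit M D" "e \<in> D" "f \<in> D"
      using component_sets_same[OF C ef] unfolding same_component_def by blast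
    have "D \<subseteq> C" by (rule circuit_subset_component[OF D(1) C D(2) ef(1)])
    with D(1) have "circuit (restrict_to M C) D"
      unfolding circuit_def by (auto simp: ground_restrict_to[OF sub] indep_restrict_to[OF sub])
    then show ?thesis
      using D ef by (auto simp: same_component_def ground_restrict_to[OF sub])
  qed (use ef in \<open>simp add: same_component_def ground_restrict_to[OF sub]\<close>)
qed

lemma contraction_depth_component:
  assumes C: "C \<in> component_sets M"
  shows "contraction_depth (restrict_to M C) \<le> contraction_depth M"
proof (cases "connected_matroid M")
  case True
  have "C = ground M"
  proof
    obtain x where x: "x \<in> C" using component_sets_nonempty[OF C] by blast
    then show "ground M \<subseteq> C"
      using True component_sets_subset[OF C] component_sets_closed[OF C x]
      unfolding connected_matroid_def by blast
  qed (rule component_sets_subset[OF C])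
  then show ?thesis by (simp add: restrict_to_ground)
next
  case False
  then have "ground M \<noteq> {}" unfolding connected_matroid_def by blast
  with False have "contraction_depth M =
      Max ((\<lambda>C. contraction_depth (restrict_to M C)) ` component_sets M)"
    by (subst contraction_depth.simps) simp
  then show ?thesis using C by (simp add: finite_component_sets)
qed

lemma contraction_depth_connected:
  assumes "connected_matroid M" "ground M \<noteq> {}"
  obtains e where "e \<in> ground M" "contraction_depth (contract M e) < contraction_depth M"
proof -
  let ?Q = "\<lambda>k. \<exists>e\<in>ground M. contraction_depth (contract M e) + 1 \<le> k"
  have "\<exists>k. ?Q k" using assms(2) by blast
  then have "?Q (LEAST k. ?Q k)" by (rule LeastI_ex)
  moreover have "contraction_depth M = (LEAST k. ?Q k)"
    using assms by (subst contraction_depth.simps) simp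
  ultimately show thesis using that by fastforce
qed

section \<open>Contraction\<close>

text \<open>In a linear dependency, the coefficient of a non-loop \<open>e\<close> is a linear function of the other
  coefficients. So \<open>A\<close> can be recovered from a representation \<open>B\<close> of the contraction by \<open>e\<close>
  once each element \<open>x\<close> is labelled with a scalar \<open>a x\<close>. The flag \<open>b\<close> tells whether \<open>e\<close> is a loop.\<close>

definition one_element_extension ::
    "(nat \<Rightarrow> 'a \<Rightarrow> 'f::field) \<Rightarrow> 'a set \<Rightarrow> 'a \<Rightarrow> bool \<Rightarrow> ('a \<Rightarrow> 'f) \<Rightarrow> (nat \<Rightarrow> 'a \<Rightarrow> 'f) \<Rightarrow> bool" where
  "one_element_extension A U e b a B \<longleftrightarrow> (\<forall>X c. X \<subseteq> U - {e} \<longrightarrow>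
     (dependency A (insert e X) c \<longleftrightarrow> dependency B X c \<and> (b \<or> c e = - (\<Sum>x\<in>X. c x * a x))))"

text \<open>For a non-loop \<open>e\<close> this is Gaussian elimination on a pivot row
  \<open>j\<close> with nonzero entry at \<open>e\<close>: \<open>a\<close> is that row normalised
  to 1 at \<open>e\<close>, and \<open>B\<close> is the matrix after elimination. A loop has a zero
  column, so its coefficient is free and \<open>A\<close> itself represents the contraction.\<close>

lemma represents_contract:
  assumes A: "represents A M" and e: "e \<in> ground M"
  obtains b a B where "represents B (contract M e)" "one_element_extension A (ground M) e b a B"
proof (cases "indep M {e}")
  case True
  have "\<exists>i. A i e \<noteq> 0"
  proof (rule ccontr)
    assume "\<not> ?thesis"
    then have "dependency A {e} (\<lambda>_. 1)" by (simp add: dependency_def)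
    with A e True show False unfolding represents_def by force
  qed
  then obtain j where j: "A j e \<noteq> 0" ..
  define a where "a x = A j x / A j e" for x
  define B where "B i x = A i x - A i e * a x" for i x
  have ext: "dependency A (insert e X) c \<longleftrightarrow>
      dependency B X c \<and> c e = - (\<Sum>x\<in>X. c x * a x)" if X: "X \<subseteq> ground M - {e}" for X c
  proof -
    have fin: "finite X" "e \<notin> X" using X finite_subset[of X "ground M - {e}"] by auto
    let ?s = "\<Sum>x\<in>X. c x * a x"
    have row: "(\<Sum>x\<in>insert e X. c x * A i x) = (\<Sum>x\<in>X. c x * B i x) + A i e * (c e + ?s)" for i
      using fin by (simp add: B_def sum_subtractf sum_distrib_left algebra_simps)
    \<comment> \<open>The pivot row of \<open>B\<close> vanishes, so in a dependency row
      \<open>j\<close> determines the coefficient of \<open>e\<close>; the remaining conditions are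
      then exactly those of \<open>B\<close>.\<close>
    have "B j x = 0" for x using j by (simp add: B_def a_def)
    then have "c e + ?s = 0" if "dependency A (insert e X) c"
      using that row[of j] j unfolding dependency_def by simp
    then show ?thesis
      unfolding dependency_def row by (auto simp: eq_neg_iff_add_eq_0)
  qed
  have "represents B (contract M e)"
    unfolding represents_def
  proof (intro allI impI)
    fix X assume "X \<subseteq> ground (contract M e)"
    then have X: "X \<subseteq> ground M - {e}" by simp
    have "indep (contract M e) X \<longleftrightarrow> indep M (insert e X)"
      using X True by (auto simp: indep_contract)
    also have "\<dots> \<longleftrightarrow> (\<forall>c. dependency A (insert e X) c \<longrightarrow> (\<forall>x\<in>insert e X. c x = 0))"
      using A X e unfolding represents_def by (meson insert_subset Diff_subset subset_trans)
    also have "\<dots> \<longleftrightarrow> (\<forall>c. dependency B X c \<longrightarrow> (\<forall>x\<in>X. c x = 0))"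
    proof
      assume *: "\<forall>c. dependency A (insert e X) c \<longrightarrow> (\<forall>x\<in>insert e X. c x = 0)"
      show "\<forall>c. dependency B X c \<longrightarrow> (\<forall>x\<in>X. c x = 0)"
      proof (intro allI impI)
        fix c assume c: "dependency B X c"
        \<comment> \<open>A dependency of \<open>B\<close> is lifted by giving \<open>e\<close> the
          coefficient that the pivot row prescribes.\<close>
        define d where "d = c(e := - (\<Sum>x\<in>X. c x * a x))"
        have d: "d x = c x" if "x \<in> X" for x using that X by (auto simp: d_def)
        have "dependency B X d" using c dependency_cong[of X d c B B] d by simp
        moreover have "d e = - (\<Sum>x\<in>X. d x * a x)"
          using d by (simp add: d_def cong: sum.cong)
        ultimately have "\<forall>x\<in>insert e X. d x = 0" using * ext[OF X] by blast
        then show "\<forall>x\<in>X. c x = 0" using d by simp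
      qed
    next
      assume *: "\<forall>c. dependency B X c \<longrightarrow> (\<forall>x\<in>X. c x = 0)"
      show "\<forall>c. dependency A (insert e X) c \<longrightarrow> (\<forall>x\<in>insert e X. c x = 0)"
      proof (intro allI impI)
        fix c assume "dependency A (insert e X) c"
        then have c: "dependency B X c" "c e = - (\<Sum>x\<in>X. c x * a x)" using ext[OF X] by blast+
        with * have "\<forall>x\<in>X. c x = 0" by blast
        then show "\<forall>x\<in>insert e X. c x = 0" using c(2) by simp
      qed
    qed
    finally show "indep (contract M e) X \<longleftrightarrow> (\<forall>c. dependency B X c \<longrightarrow> (\<forall>x\<in>X. c x = 0))" .
  qed
  then show thesis
    by (rule that[of _ False a]) (simp add: one_element_extension_def ext)
next
  case False
  then obtain c x where "dependency A {e} c" "x \<in> {e}" "c x \<noteq> 0"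
    using dependent_represents[OF A, of "{e}"] e by blast
  then have Ae: "A i e = 0" for i by (simp add: dependency_def)
  have "dependency A (insert e X) c \<longleftrightarrow> dependency A X c"
    if "X \<subseteq> ground M - {e}" for X c
  proof -
    have "finite X" "e \<notin> X" using that finite_subset[of X "ground M - {e}"] by auto
    then show ?thesis using Ae by (simp add: dependency_def)
  qed
  then have "one_element_extension A (ground M) e True (\<lambda>_. 0) A"
    by (simp add: one_element_extension_def)
  moreover have "represents A (contract M e)"
    using A False unfolding represents_def by (auto simp: indep_contract)
  ultimately show thesis using that by blast
qed

section \<open>Embeddings of labelled vector configurations\<close>

type_synonym ('a, 'f, 'l) config = "(nat \<Rightarrow> 'a \<Rightarrow> 'f) \<times> ('a \<Rightarrow> 'l) \<times> 'a set"

text \<open>Comparing dependencies on all of \<open>E\<close> also controls subsets, since a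
  dependency on a subset extends by zero. Equal dependency spaces are a stronger condition than
  equal matroids; the lift through a contraction relies on the coefficients.\<close>

definition config_emb :: "('a, 'f::field, 'l) config \<Rightarrow> ('a, 'f, 'l) config \<Rightarrow> bool" where
  "config_emb = (\<lambda>(A, l, E) (A', l', E'). \<exists>f. inj_on f E \<and> f ` E \<subseteq> E' \<and>
     (\<forall>x\<in>E. l' (f x) = l x) \<and>
     (\<forall>c. dependency A E c \<longleftrightarrow> dependency (\<lambda>i x. A' i (f x)) E c))"

definition configs :: "nat \<Rightarrow> 'l set \<Rightarrow> ('a, 'f::field, 'l) config set" where
  "configs k L = {(A, l, E). l ` E \<subseteq> L \<and>
     (\<exists>M. ground M = E \<and> represents A M \<and> contraction_depth M \<le> k)}"

text \<open>The condition \<open>E \<noteq> {}\<close> guarantees an element to contract and makes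
  the class empty for \<open>k = 0\<close>.\<close>

definition connected_configs :: "nat \<Rightarrow> 'l set \<Rightarrow> ('a, 'f::field, 'l) config set" where
  "connected_configs k L = {(A, l, E). l ` E \<subseteq> L \<and> E \<noteq> {} \<and>
     (\<exists>M. ground M = E \<and> represents A M \<and> contraction_depth M \<le> k \<and> connected_matroid M)}"

text \<open>The embedding is extended by sending \<open>e\<close> to \<open>e'\<close>. Since
  \<open>f\<close> preserves the scalars and the flag \<open>b\<close> is the same on both sides,
  the condition on the coefficient of \<open>e\<close> turns into that for
  \<open>e'\<close>.\<close>

lemma config_emb_one_element_extension:
  assumes ext: "one_element_extension A E e b a B" "one_element_extension A' E' e' b a' B'"
    and e: "e \<in> E" "e' \<in> E'" "l' e' = l e"
    and emb: "config_emb (B, \<lambda>x. a x # l x, E - {e}) (B', \<lambda>x. a' x # l' x, E' - {e'})"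
  shows "config_emb (A, l, E) (A', l', E')"
proof -
  obtain f where f: "inj_on f (E - {e})" "f ` (E - {e}) \<subseteq> E' - {e'}"
      "\<And>x. x \<in> E - {e} \<Longrightarrow> a' (f x) = a x \<and> l' (f x) = l x"
      "\<And>c. dependency B (E - {e}) c \<longleftrightarrow> dependency (\<lambda>i x. B' i (f x)) (E - {e}) c"
    using emb unfolding config_emb_def by auto
  define g where "g = f(e := e')"
  have gf: "g x = f x" if "x \<in> E - {e}" for x using that by (simp add: g_def)
  have inj: "inj_on g E"
    using f(1,2) by (auto simp: g_def inj_on_def)
  have img: "g ` E = insert e' (f ` (E - {e}))"
    using e(1) by (auto simp: g_def)
  have "dependency A E c \<longleftrightarrow> dependency (\<lambda>i x. A' i (g x)) E c" for c
  proof -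
    define d where "d y = c (inv_into E g y)" for y
    have d: "d (g x) = c x" if "x \<in> E" for x using that inj by (simp add: d_def)
    have df: "d (f x) = c x" if "x \<in> E - {e}" for x using d[of x] gf that by simp
    have de: "d e' = c e" using d[OF e(1)] by (simp add: g_def)
    have "dependency (\<lambda>i x. A' i (g x)) E c \<longleftrightarrow> dependency A' (g ` E) d"
      unfolding dependency_reindex[OF inj] using d by (intro dependency_cong) auto
    \<comment> \<open>The extension property of the larger configuration is applied to the image of
      \<open>f\<close> only, which is why it is stated for every \<open>X\<close> and not just for
      the whole ground set.\<close>
    also have "\<dots> \<longleftrightarrow> dependency B' (f ` (E - {e})) d \<and>
        (b \<or> d e' = - (\<Sum>y\<in>f ` (E - {e}). d y * a' y))"
      using ext(2) f(2) unfolding one_element_extension_def img by blast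
    also have "dependency B' (f ` (E - {e})) d \<longleftrightarrow> dependency B (E - {e}) c"
      unfolding dependency_reindex[OF f(1)] f(4) using df by (intro dependency_cong) auto
    also have "(\<Sum>y\<in>f ` (E - {e}). d y * a' y) = (\<Sum>x\<in>E - {e}. c x * a x)"
      unfolding sum.reindex[OF f(1)] using df f(3) by (intro sum.cong) auto
    also have "dependency B (E - {e}) c \<and> (b \<or> d e' = - (\<Sum>x\<in>E - {e}. c x * a x)) \<longleftrightarrow>
        dependency A (insert e (E - {e})) c"
      unfolding ext(1)[unfolded one_element_extension_def, rule_format, OF subset_refl] de ..
    finally show ?thesis unfolding insert_Diff[OF e(1)] by blast
  qed
  moreover have "g ` E \<subseteq> E'" using img f(2) e(2) by auto
  moreover have "l' (g x) = l x" if "x \<in> E" for x using that f(3) e(3) by (auto simp: g_def)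
  ultimately show ?thesis unfolding config_emb_def using inj by auto
qed

lemma connected_configs_contract:
  assumes "(A, l, E) \<in> connected_configs (Suc k) L"
  obtains e b a B where "e \<in> E" "one_element_extension A E e b a B"
    "(B, \<lambda>x. a x # l x, E - {e}) \<in> configs k ((\<lambda>(s, t). s # t) ` (UNIV \<times> L))"
proof -
  obtain M where M: "ground M = E" "represents A M" "contraction_depth M \<le> Suc k"
      "connected_matroid M" and E: "E \<noteq> {}" "l ` E \<subseteq> L"
    using assms unfolding connected_configs_def by blast
  then obtain e where e: "e \<in> ground M" "contraction_depth (contract M e) < contraction_depth M"
    using contraction_depth_connected by metis
  obtain b a B where B: "represents B (contract M e)" "one_element_extension A (ground M) e b a B"
    by (rule represents_contract[OF M(2) e(1)]) (rule that)
  have "(B, \<lambda>x. a x # l x, E - {e}) \<in> configs k ((\<lambda>(s, t). s # t) ` (UNIV \<times> L))"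
    unfolding configs_def using B(1) M E e by (fastforce intro!: exI[of _ "contract M e"])
  then show thesis using that e(1) B(2) M(1) by blast
qed

lemma almost_full_on_connected_configs_Suc:
  fixes L :: "'f::{field,finite} list set"
  assumes L: "finite L"
    and IH: "almost_full_on config_emb
      (configs k ((\<lambda>(s, t). s # t) ` (UNIV \<times> L)) :: ('a, 'f, 'f list) config set)"
  shows "almost_full_on config_emb (connected_configs (Suc k) L :: ('a, 'f, 'f list) config set)"
  unfolding almost_full_on_def
proof (intro allI impI)
  fix s :: "nat \<Rightarrow> ('a, 'f, 'f list) config"
  assume s: "range s \<subseteq> connected_configs (Suc k) L"
  define A where "A i = fst (s i)" for i
  define l where "l i = fst (snd (s i))" for i
  define E where "E i = snd (snd (s i))" for i
  have s_eq: "s i = (A i, l i, E i)" for i by (simp add: A_def l_def E_def)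
  have mem: "(A i, l i, E i) \<in> connected_configs (Suc k) L" for i using s s_eq by (metis rangeI subsetD)
  define Q where "Q i t \<longleftrightarrow> (case t of (e, b, a, B) \<Rightarrow> e \<in> E i \<and>
      one_element_extension (A i) (E i) e b a B \<and>
      (B, \<lambda>x. a x # l i x, E i - {e}) \<in> configs k ((\<lambda>(s, t). s # t) ` (UNIV \<times> L)))" for i t
  have "\<exists>t. Q i t" for i
    by (rule connected_configs_contract[OF mem[of i]])
      (rule exI[where x = "(_, _, _, _)"], simp add: Q_def)
  then obtain t where t: "\<And>i. Q i (t i)" by metis
  define e where "e i = fst (t i)" for i
  define b where "b i = fst (snd (t i))" for i
  define a where "a i = fst (snd (snd (t i)))" for i
  define B where "B i = snd (snd (snd (t i)))" for i
  have e: "e i \<in> E i" and ext: "one_element_extension (A i) (E i) (e i) (b i) (a i) (B i)"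
    and B: "(B i, \<lambda>x. a i x # l i x, E i - {e i}) \<in> configs k ((\<lambda>(s, t). s # t) ` (UNIV \<times> L))" for i
    using t[of i] by (simp_all add: Q_def e_def b_def a_def B_def split: prod.splits)
  \<comment> \<open>The embedding of the contractions says nothing about the contracted elements.
    Their loop flags and labels take finitely many values, so they can be made to agree by
    restricting to one colour class.\<close>
  have "range (\<lambda>i. (b i, l i (e i))) \<subseteq> UNIV \<times> L"
    using mem e unfolding connected_configs_def by blast
  then have fin: "finite (range (\<lambda>i. (b i, l i (e i))))"
    by (rule finite_subset) (use L in simp)
  obtain i j where ij: "i < j"
      "config_emb (B i, \<lambda>x. a i x # l i x, E i - {e i}) (B j, \<lambda>x. a j x # l j x, E j - {e j})"
      "(b i, l i (e i)) = (b j, l j (e j))"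
    by (rule almost_full_on_finite_colouring[OF IH,
          where s = "\<lambda>i. (B i, \<lambda>x. a i x # l i x, E i - {e i})", OF B fin]) (rule that)
  have "config_emb (s i) (s j)"
    unfolding s_eq
    by (rule config_emb_one_element_extension[OF _ ext e e]) (use ext[of i] ij in simp_all)
  then show "\<exists>i j. i < j \<and> config_emb (s i) (s j)" using ij(1) by blast
qed

text \<open>Distinct components have disjoint targets, so the partial maps glue to an injection;
  dependencies glue because they split along components on both sides.\<close>

lemma config_emb_components:
  assumes M: "represents A M" "represents A' M'"
    and g: "inj_on g (component_sets M)" "g ` component_sets M \<subseteq> component_sets M'"
    and emb: "\<And>C. C \<in> component_sets M \<Longrightarrow> config_emb (A, l, C) (A', l', g C)"
  shows "config_emb (A, l, ground M) (A', l', ground M')"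
proof -
  have "\<forall>C\<in>component_sets M. \<exists>f. inj_on f C \<and> f ` C \<subseteq> g C \<and> (\<forall>x\<in>C. l' (f x) = l x) \<and>
      (\<forall>c. dependency A C c \<longleftrightarrow> dependency (\<lambda>i x. A' i (f x)) C c)"
    using emb unfolding config_emb_def by simp
  then obtain F where F: "\<And>C. C \<in> component_sets M \<Longrightarrow> inj_on (F C) C"
      "\<And>C. C \<in> component_sets M \<Longrightarrow> F C ` C \<subseteq> g C"
      "\<And>C x. C \<in> component_sets M \<Longrightarrow> x \<in> C \<Longrightarrow> l' (F C x) = l x"
      "\<And>C c. C \<in> component_sets M \<Longrightarrow>
        dependency A C c \<longleftrightarrow> dependency (\<lambda>i x. A' i (F C x)) C c"
    by metis
  define f where "f x = F (THE C. C \<in> component_sets M \<and> x \<in> C) x" for x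
  have f: "f x = F C x" if "C \<in> component_sets M" "x \<in> C" for C x
  proof -
    have "(THE C. C \<in> component_sets M \<and> x \<in> C) = C"
    proof (rule the_equality)
      fix D assume "D \<in> component_sets M \<and> x \<in> D"
      then show "D = C" by (elim conjE) (rule component_sets_disjoint[OF _ that(1) _ that(2)])
    qed (use that in blast)
    then show ?thesis by (simp add: f_def)
  qed
  have fg: "f x \<in> g C" if "C \<in> component_sets M" "x \<in> C" for C x
    using f[OF that] F(2) that by auto
  have in_comp: "\<exists>C\<in>component_sets M. x \<in> C" if "x \<in> ground M" for x
    using that by (metis UnionE Union_component_sets)
  have comp_f: "C = D"
    if "C \<in> component_sets M" "D \<in> component_sets M" "x \<in> D" "f x \<in> g C" for C D x
  proof -
    have "g D = g C"
      using component_sets_disjoint[of "g D" M' "g C" "f x"] fg that g(2) by blast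
    then show ?thesis using g(1) that by (auto dest: inj_onD)
  qed
  have inj: "inj_on f (ground M)"
  proof (rule inj_onI)
    fix x y assume xy: "x \<in> ground M" "y \<in> ground M" "f x = f y"
    then obtain C where C: "C \<in> component_sets M" "x \<in> C" using in_comp by blast
    obtain D where D: "D \<in> component_sets M" "y \<in> D" using in_comp xy(2) by blast
    have "C = D" using comp_f[OF C(1) D] fg[OF C] xy(3) by simp
    then show "x = y" using f[OF C] f[OF D] F(1)[OF C(1)] C D xy(3) by (auto dest: inj_onD)
  qed
  have sub: "f ` ground M \<subseteq> ground M'"
  proof clarify
    fix x assume "x \<in> ground M"
    then obtain C where C: "C \<in> component_sets M" "x \<in> C" using in_comp by blast
    then have "g C \<in> component_sets M'" using g(2) by blast
    then show "f x \<in> ground M'" using fg[OF C] component_sets_subset by blast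
  qed
  have "dependency A (ground M) c \<longleftrightarrow> dependency (\<lambda>i x. A' i (f x)) (ground M) c" for c
  proof -
    \<comment> \<open>The coefficients \<open>c\<close> are carried to \<open>M'\<close> with
      default 0 off the image. The zero default makes \<open>d\<close> a dependency on every
      component outside the range of \<open>g\<close>, and lets a component \<open>g C\<close> be
      cut down to the image of \<open>C\<close>.\<close>
    define d where "d y = (if y \<in> f ` ground M then c (inv_into (ground M) f y) else 0)" for y
    have d: "d (f x) = c x" if "x \<in> ground M" for x
      using that inj by (simp add: d_def)
    have on_C: "dependency A C c \<longleftrightarrow> dependency A' (g C) d" if C: "C \<in> component_sets M" for C
    proof -
      have CM: "C \<subseteq> ground M" by (rule component_sets_subset[OF C])
      have gC: "g C \<in> component_sets M'" using g(2) C by blast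
      have "dependency A' (g C) d \<longleftrightarrow> dependency A' (f ` C) d"
      proof (rule dependency_superset)
        show "finite (g C)"
          using component_sets_subset[OF gC] finite_ground finite_subset by blast
        show "f ` C \<subseteq> g C" using fg C by blast
        show "d y = 0" if y: "y \<in> g C - f ` C" for y
        proof (rule ccontr)
          assume "d y \<noteq> 0"
          then obtain x where x: "x \<in> ground M" "y = f x" by (auto simp: d_def split: if_splits)
          then obtain D where "D \<in> component_sets M" "x \<in> D" using in_comp by blast
          then show False using comp_f[OF C, of D x] x y by blast
        qed
      qed
      also have "\<dots> \<longleftrightarrow> dependency (\<lambda>i x. A' i (F C x)) C c"
        unfolding dependency_reindex[OF inj_on_subset[OF inj CM]]
        by (rule dependency_cong) (use CM d in blast, simp add: f[OF C])
      finally show ?thesis using F(4)[OF C] by simp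
    qed
    have off: "dependency A' D d" if D: "D \<in> component_sets M'" "D \<notin> g ` component_sets M" for D
    proof -
      have "d y = 0" if y: "y \<in> D" for y
      proof (rule ccontr)
        assume "d y \<noteq> 0"
        then obtain x where x: "x \<in> ground M" "y = f x" by (auto simp: d_def split: if_splits)
        then obtain C where "C \<in> component_sets M" "x \<in> C" using in_comp by blast
        then show False
          using fg[of C x] component_sets_disjoint[OF D(1), of "g C" y] g(2) D(2) x y by blast
      qed
      then show ?thesis by (simp add: dependency_def)
    qed
    have "dependency A (ground M) c \<longleftrightarrow> (\<forall>C\<in>component_sets M. dependency A' (g C) d)"
      using on_C by (simp add: dependency_components_iff[OF M(1)])
    also have "\<dots> \<longleftrightarrow> dependency A' (ground M') d"
      unfolding dependency_components_iff[OF M(2)] using off g(2) by blast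
    also have "\<dots> \<longleftrightarrow> dependency A' (f ` ground M) d"
      by (rule dependency_superset) (use sub in \<open>auto simp: d_def\<close>)
    also have "\<dots> \<longleftrightarrow> dependency (\<lambda>i x. A' i (f x)) (ground M) c"
      unfolding dependency_reindex[OF inj] using d by (intro dependency_cong) auto
    finally show ?thesis .
  qed
  moreover have "l' (f x) = l x" if "x \<in> ground M" for x
    using in_comp[OF that] f F(3) by force
  ultimately show ?thesis unfolding config_emb_def using inj sub by auto
qed

lemma config_component:
  assumes "represents A M" "contraction_depth M \<le> k" "l ` ground M \<subseteq> L" "C \<in> component_sets M"
  shows "(A, l, C) \<in> connected_configs k L"
proof -
  note sub = component_sets_subset[OF assms(4)]
  have "ground (restrict_to M C) = C" "represents A (restrict_to M C)"
    "contraction_depth (restrict_to M C) \<le> k" "connected_matroid (restrict_to M C)"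
    using ground_restrict_to[OF sub] represents_restrict_to[OF assms(1) sub]
      contraction_depth_component[OF assms(4)] assms(2) connected_restrict_to_component[OF assms(4)]
    by linarith+
  then show ?thesis
    using assms(3) sub component_sets_nonempty[OF assms(4)] unfolding connected_configs_def by blast
qed

text \<open>Components are listed without repetition in an arbitrary order; from Higman's embedding
  only the induced injection between components is kept. Components that are not hit end up outside
  the image.\<close>

lemma almost_full_on_configs:
  assumes "almost_full_on config_emb (connected_configs k L :: ('a, 'f::field, 'l) config set)"
  shows "almost_full_on config_emb (configs k L :: ('a, 'f, 'l) config set)"
  unfolding almost_full_on_def
proof (intro allI impI)
  fix s :: "nat \<Rightarrow> ('a, 'f, 'l) config"
  assume s: "range s \<subseteq> configs k L"
  define A where "A i = fst (s i)" for i
  define l where "l i = fst (snd (s i))" for i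
  define Q where "Q i M \<longleftrightarrow> s i = (A i, l i, ground M) \<and> l i ` ground M \<subseteq> L \<and>
      represents (A i) M \<and> contraction_depth M \<le> k" for i M
  have "\<exists>M. Q i M" for i
  proof -
    have "s i \<in> configs k L" using s by blast
    then show ?thesis unfolding configs_def A_def l_def Q_def by (cases "s i") auto
  qed
  then obtain M where "\<And>i. Q i (M i)" by metis
  then have M: "\<And>i. s i = (A i, l i, ground (M i))" "\<And>i. l i ` ground (M i) \<subseteq> L"
      "\<And>i. represents (A i) (M i)" "\<And>i. contraction_depth (M i) \<le> k"
    unfolding Q_def by simp_all
  have "\<forall>i. \<exists>xs. set xs = component_sets (M i) \<and> distinct xs"
    using finite_distinct_list[OF finite_component_sets] by blast
  then obtain xs where xs: "\<And>i. set (xs i) = component_sets (M i)" "\<And>i. distinct (xs i)"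
    by metis
  let ?ys = "\<lambda>i. map (\<lambda>C. (A i, l i, C)) (xs i)"
  have "?ys i \<in> lists (connected_configs k L)" for i
    using config_component[OF M(3,4,2)] xs(1) by auto
  then obtain i j where ij: "i < j" "list_emb config_emb (?ys i) (?ys j)"
    using almost_full_onD[OF Higman[OF assms], of ?ys] by blast
  have distinct: "distinct (?ys i)" for i using xs(2) by (simp add: distinct_map inj_on_def)
  obtain g where g: "inj_on g (set (?ys i))" "g ` set (?ys i) \<subseteq> set (?ys j)"
      "\<And>y. y \<in> set (?ys i) \<Longrightarrow> config_emb y (g y)"
    by (rule list_emb_inj_on[OF ij(2) distinct distinct]) (rule that)
  \<comment> \<open>All triples in one list share their matrix and labelling, so \<open>g\<close>
    acts only on the third entry, the component.\<close>
  define h where "h C = snd (snd (g (A i, l i, C)))" for C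
  have gh: "g (A i, l i, C) = (A j, l j, h C)" "h C \<in> component_sets (M j)"
    if "C \<in> component_sets (M i)" for C
  proof -
    have "g (A i, l i, C) \<in> set (?ys j)" using g(2) that xs(1) by auto
    then show "g (A i, l i, C) = (A j, l j, h C)" "h C \<in> component_sets (M j)"
      using xs(1) by (auto simp: h_def)
  qed
  have "config_emb (s i) (s j)"
    unfolding M(1)
  proof (rule config_emb_components[OF M(3) M(3)])
    show "inj_on h (component_sets (M i))"
    proof (rule inj_onI)
      fix C D assume CD: "C \<in> component_sets (M i)" "D \<in> component_sets (M i)" "h C = h D"
      then have "g (A i, l i, C) = g (A i, l i, D)" using gh by simp
      then have "(A i, l i, C) = (A i, l i, D)"
        by (rule inj_onD[OF g(1)]) (use CD xs(1) in simp_all)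
      then show "C = D" by simp
    qed
    show "h ` component_sets (M i) \<subseteq> component_sets (M j)" using gh by blast
    show "config_emb (A i, l i, C) (A j, l j, h C)" if "C \<in> component_sets (M i)" for C
      using g(3)[of "(A i, l i, C)"] gh(1)[OF that] that xs(1) by simp
  qed
  then show "\<exists>i j. i < j \<and> config_emb (s i) (s j)" using ij(1) by blast
qed

text \<open>Labels are lists of scalars so that prepending one more scalar stays within the same
  type; the induction on \<open>k\<close> keeps \<open>L\<close> arbitrary because each contraction
  enlarges the label set.\<close>

lemma almost_full_on_configs_finite_labels:
  fixes L :: "'f::{field,finite} list set"
  assumes "finite L"
  shows "almost_full_on config_emb (configs k L :: ('a, 'f, 'f list) config set)"
  using assms
proof (induction k arbitrary: L)
  case 0
  have "connected_configs 0 L = ({} :: ('a, 'f, 'f list) config set)"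
    unfolding connected_configs_def using contraction_depth_connected by force
  then show ?case
    by (intro almost_full_on_configs) (simp add: almost_full_on_def)
next
  case (Suc k)
  have "finite ((\<lambda>(s, t). s # t) ` ((UNIV :: 'f set) \<times> L))" using Suc.prems by simp
  from almost_full_on_configs[OF almost_full_on_connected_configs_Suc[OF Suc.prems Suc.IH[OF this]]]
  show ?case .
qed

text \<open>Extension by zero passes the correspondence of dependencies to every subset, and
  independence is the absence of nonzero dependencies. The set to delete is the complement of the
  image.\<close>

lemma config_emb_imp_restriction:
  assumes M: "represents A M" "represents A' M'"
    and emb: "config_emb (A, l, ground M) (A', l', ground M')"
  shows "\<exists>X\<subseteq>ground M'. matroid_iso M (delete M' X)"
proof -
  obtain f where f: "inj_on f (ground M)" "f ` ground M \<subseteq> ground M'"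
      "\<And>c. dependency A (ground M) c \<longleftrightarrow> dependency (\<lambda>i x. A' i (f x)) (ground M) c"
    using emb unfolding config_emb_def by auto
  have "indep M X \<longleftrightarrow> indep M' (f ` X)" if X: "X \<subseteq> ground M" for X
  proof -
    have inj: "inj_on f X" using inj_on_subset[OF f(1) X] .
    have dep: "dependency A X c \<longleftrightarrow> dependency (\<lambda>i x. A' i (f x)) X c" for c
      using f(3)[of "\<lambda>x. if x \<in> X then c x else 0"]
      unfolding dependency_extend_zero[OF finite_ground X] .
    have "indep M' (f ` X) \<longleftrightarrow> (\<forall>d. dependency A' (f ` X) d \<longrightarrow> (\<forall>y\<in>f ` X. d y = 0))"
      using M(2) X f(2) unfolding represents_def by (meson image_mono subset_trans)
    also have "\<dots> \<longleftrightarrow> (\<forall>c. dependency A X c \<longrightarrow> (\<forall>x\<in>X. c x = 0))"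
    proof (intro iffI allI impI)
      fix c assume *: "\<forall>d. dependency A' (f ` X) d \<longrightarrow> (\<forall>y\<in>f ` X. d y = 0)"
        and c: "dependency A X c"
      define d where "d y = c (inv_into X f y)" for y
      have d: "d (f x) = c x" if "x \<in> X" for x using that inj by (simp add: d_def)
      have "dependency A' (f ` X) d \<longleftrightarrow> dependency (\<lambda>i x. A' i (f x)) X c"
        unfolding dependency_reindex[OF inj] using d by (intro dependency_cong) auto
      with c dep * have "\<forall>y\<in>f ` X. d y = 0" by blast
      then show "\<forall>x\<in>X. c x = 0" using d by simp
    next
      fix d assume "\<forall>c. dependency A X c \<longrightarrow> (\<forall>x\<in>X. c x = 0)" "dependency A' (f ` X) d"
      then show "\<forall>y\<in>f ` X. d y = 0" unfolding dependency_reindex[OF inj] dep by blast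
    qed
    also have "\<dots> \<longleftrightarrow> indep M X" using M(1) X unfolding represents_def by blast
    finally show ?thesis by simp
  qed
  moreover have "ground M' - (ground M' - f ` ground M) = f ` ground M" using f(2) by blast
  ultimately have "matroid_iso M (delete M' (ground M' - f ` ground M))"
    unfolding matroid_iso_def using f(1)
    by (intro exI[of _ f]) (auto simp: indep_delete bij_betw_def)
  then show ?thesis by blast
qed

theorem theorem6p1:
  fixes M :: "nat \<Rightarrow> 'a matroid" and k :: int
  assumes "\<And>i. representable_over TYPE('f::{field,finite}) (M i)"
    and "\<And>i. int (contraction_depth (M i)) \<le> k"
  shows "\<exists>i j. i < j \<and> (\<exists>X\<subseteq>ground (M j). matroid_iso (M i) (delete (M j) X))"
proof -
  have "\<exists>A :: nat \<Rightarrow> 'a \<Rightarrow> 'f. represents A (M i)" for i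
    using representable_over_represents[OF assms(1)] by metis
  then obtain A :: "nat \<Rightarrow> nat \<Rightarrow> 'a \<Rightarrow> 'f" where A: "\<And>i. represents (A i) (M i)" by metis
  have "contraction_depth (M i) \<le> nat k" for i using assms(2)[of i] by linarith
  \<comment> \<open>All elements start with the empty label, so the initial label set is a
    singleton; every contraction prepends one scalar.\<close>
  then have mem: "(A i, \<lambda>_. [], ground (M i)) \<in> configs (nat k) {[] :: 'f list}" for i
    unfolding configs_def using A by auto
  have fin: "finite {[] :: 'f list}" by simp
  obtain i j where ij: "i < j"
      "config_emb (A i, \<lambda>_. [] :: 'f list, ground (M i)) (A j, \<lambda>_. [], ground (M j))"
    by (rule almost_full_onD[OF almost_full_on_configs_finite_labels[OF fin],
          where s = "\<lambda>i. (A i, \<lambda>_. [], ground (M i))", OF mem]) (rule that)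
  from ij(1) config_emb_imp_restriction[OF A A ij(2)] show ?thesis
    by (intro exI[of _ i] exI[of _ j] conjI)
qed

end
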